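(* Let $\mathbb{A}$ be a finite non-empty set and let $x\in\mathbb{A}^{\mathbb{N}}$ be aperiodic. Then $x$ admits a Lyndon word in its shift orbit closure.
   Context: An infinite word is aperiodic if it is not ultimately periodic. The shift orbit closure of $x$ is the set of infinite words all of whose finite factors are factors of $x$. A word $y\in\mathbb{A}^{\mathbb{N}}$ is Lyndon if there exists a linear order $\leq$ on $\mathbb{A}$ with respect to which $y$ is strictly lexicographically smaller than each of its proper suffixes (tails). *)

theory Defs
  imports "HOL-Library.Omega_Words_Fun"
begin

definition ultimately_periodic :: "'a word \<Rightarrow> bool" where
  "ultimately_periodic x \<longleftrightarrow> (\<exists>u v. v \<noteq> [] \<and> x = u \<frown> v\<^sup>\<omega>)"

definition aperiodic :: "'a word \<Rightarrow> bool" where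
  "aperiodic x \<longleftrightarrow> \<not> ultimately_periodic x"

definition factors :: "'a word \<Rightarrow> 'a list set" where
  "factors x = {x [i \<rightarrow> j] | i j. True}"

definition shift_orbit_closure :: "'a word \<Rightarrow> 'a word set" where
  "shift_orbit_closure x = {y. factors y \<subseteq> factors x}"

text \<open>Here \<open>r\<close> is a reflexive order; the strict part is used at the first difference.\<close>

definition lex_less :: "'a rel \<Rightarrow> 'a word \<Rightarrow> 'a word \<Rightarrow> bool" where
  "lex_less r y z \<longleftrightarrow> (\<exists>n. (\<forall>i<n. y i = z i) \<and> y n \<noteq> z n \<and> (y n, z n) \<in> r)"

text \<open>
  The proper suffixes (tails) of \<open>y\<close> are the words \<open>suffix k y\<close> with \<open>k > 0\<close>.
  A tail equal to \<open>y\<close> itself counts as proper, so purely periodic words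
  are not Lyndon.
\<close>

definition lyndon_on :: "'a set \<Rightarrow> 'a word \<Rightarrow> bool" where
  "lyndon_on A y \<longleftrightarrow> range y \<subseteq> A \<and>
     (\<exists>r. linear_order_on A r \<and> (\<forall>k>0. lex_less r y (suffix k y)))"

end

theory Submission
  imports Defs
begin

text \<open>
  Write \<open>X\<close> for the shift orbit closure of \<open>x\<close>, and fix a linear order \<open>r\<close> on the alphabet. The
  closure \<open>X\<close> has a lexicographically least word \<open>m\<close>. Since \<open>X\<close> is closed under taking tails, \<open>m\<close>
  is at most each of its tails, so it is a Lyndon word unless it is purely periodic. It therefore
  suffices to derive a contradiction from the assumption that \<open>X\<close> contains no Lyndon word, in which
  case the least words of \<open>X\<close> for \<open>r\<close> and for the converse order are both purely periodic.

  The main idea is that a word of \<open>X\<close> need not be least in \<open>X\<close> to be Lyndon: if \<open>y \<in> X\<close> begins with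
  a prefix \<open>q\<close> of the least word \<open>m\<close> and \<open>q\<close> occurs nowhere else in \<open>y\<close>, then \<open>y\<close> is Lyndon, because
  a tail that is not larger than \<open>y\<close> would be squeezed between \<open>m\<close> and \<open>y\<close> and would begin with \<open>q\<close>
  as well (\<open>lyndon_if_prefix_isolated\<close>). Suppose some purely periodic \<open>z \<in> X\<close> does not contain
  \<open>q\<close>. Arbitrarily long prefixes of \<open>z\<close> occur in \<open>x\<close> after an occurrence of \<open>q\<close>; reading \<open>x\<close> from
  the last occurrence of \<open>q\<close> before such a prefix, and passing to a limit, gives a word \<open>y\<close> as above
  (\<open>lyndon_if_prefix_avoided\<close>). Hence, if \<open>X\<close> contains no Lyndon word, the least words of \<open>X\<close> for all
  orders have the same finite factors.

  This is impossible for an aperiodic \<open>x\<close>. Let \<open>z\<close> be the least word for \<open>r\<close>, of period \<open>p\<close>. A long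
  prefix of \<open>z\<close> occurs in \<open>x\<close>, and since \<open>x\<close> is not ultimately periodic, following this occurrence
  leads to a first position where \<open>x\<close> has a letter \<open>a\<close> and \<open>z\<close> has another letter \<open>b\<close>. One
  of \<open>r\<close> and its converse puts \<open>a\<close> before \<open>b\<close>. A long prefix of the least word for that order has
  an occurrence in \<open>z\<close> that starts within the first period, so the corresponding tail of \<open>x\<close>
  follows that least word up to the break and is then smaller.
\<close>

section \<open>Lexicographic comparison of infinite words\<close>

definition agree :: "nat \<Rightarrow> 'a word \<Rightarrow> 'a word \<Rightarrow> bool" where
  "agree n y z \<longleftrightarrow> (\<forall>i<n. y i = z i)"

lemma first_difference:
  assumes "y \<noteq> z"
  obtains n where "agree n y z" "y n \<noteq> z n"
proof -
  from assms have ex: "\<exists>n. y n \<noteq> z n" by auto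
  let ?n = "LEAST n. y n \<noteq> z n"
  have "agree ?n y z" unfolding agree_def using not_less_Least by blast
  moreover have "y ?n \<noteq> z ?n" using LeastI_ex[OF ex] .
  ultimately show ?thesis by (rule that)
qed

lemma lex_less_asym:
  assumes "antisym r" "lex_less r y z" "lex_less r z y"
  shows False
proof -
  obtain n where n: "\<forall>i<n. y i = z i" "y n \<noteq> z n" "(y n, z n) \<in> r"
    using assms(2) by (auto simp: lex_less_def)
  obtain k where k: "\<forall>i<k. z i = y i" "z k \<noteq> y k" "(z k, y k) \<in> r"
    using assms(3) by (auto simp: lex_less_def)
  have "n = k" using n(1,2) k(1,2) by (metis nat_neq_iff)
  with n k assms(1) show False by (auto dest: antisymD)
qed

section \<open>The shift orbit closure\<close>

lemma in_closure_iff: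
  "y \<in> shift_orbit_closure x \<longleftrightarrow> (\<forall>n. \<exists>i. agree n y (suffix i x))"
proof
  assume y: "y \<in> shift_orbit_closure x"
  show "\<forall>n. \<exists>i. agree n y (suffix i x)"
  proof
    fix n
    have "prefix n y \<in> factors y" by (auto simp: factors_def)
    with y have "prefix n y \<in> factors x" by (auto simp: shift_orbit_closure_def)
    then obtain i j where ij: "prefix n y = x [i \<rightarrow> j]"
      unfolding factors_def by blast
    then have len: "n = j - i" by (metis diff_zero subsequence_length)
    have "y k = x (i + k)" if "k < n" for k
    proof -
      have "prefix n y ! k = x [i \<rightarrow> j] ! k" by (simp add: ij)
      with that len show ?thesis by simp
    qed
    then have "agree n y (suffix i x)" by (simp add: agree_def)
    then show "\<exists>i. agree n y (suffix i x)" ..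
  qed
next
  assume ag: "\<forall>n. \<exists>i. agree n y (suffix i x)"
  have "y [k \<rightarrow> l] \<in> factors x" for k l
  proof -
    obtain i where i: "agree l y (suffix i x)" using ag by blast
    have "y [k \<rightarrow> l] = x [i + k \<rightarrow> i + l]"
    proof (rule nth_equalityI)
      fix h assume "h < length (y [k \<rightarrow> l])"
      then have "h < l - k" by simp
      then show "y [k \<rightarrow> l] ! h = x [i + k \<rightarrow> i + l] ! h"
        using i by (simp add: agree_def add.assoc)
    qed simp
    then show ?thesis by (auto simp: factors_def)
  qed
  then show "y \<in> shift_orbit_closure x"
    by (auto simp: shift_orbit_closure_def factors_def)
qed

lemma suffix_in_closure:
  assumes "y \<in> shift_orbit_closure x"
  shows "suffix k y \<in> shift_orbit_closure x"
  unfolding in_closure_iff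
proof
  fix n
  obtain i where "agree (k + n) y (suffix i x)"
    using assms by (auto simp: in_closure_iff)
  then have "agree n (suffix k y) (suffix (i + k) x)"
    by (auto simp: agree_def add.assoc)
  then show "\<exists>i. agree n (suffix k y) (suffix i x)" ..
qed

lemma tail_in_closure: "suffix i x \<in> shift_orbit_closure x"
  by (auto simp: in_closure_iff agree_def)

lemma closure_range:
  assumes "y \<in> shift_orbit_closure x" "range x \<subseteq> A"
  shows "range y \<subseteq> A"
proof
  fix a assume "a \<in> range y"
  then obtain n where n: "a = y n" by auto
  obtain i where "agree (Suc n) y (suffix i x)" using assms(1) by (auto simp: in_closure_iff)
  then have "y n = x (i + n)" by (simp add: agree_def)
  with n assms(2) show "a \<in> A" by auto
qed

section \<open>Infinite words from extendable finite words\<close>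

lemma linear_order_least:
  assumes r: "linear_order_on A r" and "finite B" "B \<noteq> {}" "B \<subseteq> A"
  shows "\<exists>a\<in>B. \<forall>b\<in>B. (a, b) \<in> r"
  using assms(2-)
proof (induction B rule: finite_ne_induct)
  case (singleton c)
  then show ?case
    using r by (auto simp: order_on_defs refl_on_def)
next
  case (insert c B)
  then obtain a where a: "a \<in> B" "\<forall>b\<in>B. (a, b) \<in> r" by auto
  have *: "(a, c) \<in> r \<or> (c, a) \<in> r" "(c, c) \<in> r" "trans r"
    using r a insert.prems insert.hyps by (auto simp: order_on_defs total_on_def refl_on_def)
  then show ?case using a by (auto dest: transD)
qed

text \<open>
  Choosing the least admissible next letter at every step cannot get stuck, and the first letter at
  which another admissible word \<open>y\<close> differs from \<open>m\<close> was among the candidates when the letter of \<open>m\<close>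
  was chosen. With \<open>P\<close> the set of factors of \<open>x\<close> this produces the least word of the closure; with
  \<open>P\<close> the set of common prefixes of infinitely many words of a sequence it produces a limit point.
\<close>

lemma greedy_word:
  fixes P :: "'a list \<Rightarrow> bool"
  assumes r: "linear_order_on A r" and fin: "finite A"
    and nil: "P []"
    and extend: "\<And>w. P w \<Longrightarrow> \<exists>a\<in>A. P (w @ [a])"
    and alphabet: "\<And>w a. P (w @ [a]) \<Longrightarrow> a \<in> A"
  obtains m where "\<And>n. P (prefix n m)"
    "\<And>y. (\<And>n. P (prefix n y)) \<Longrightarrow> y = m \<or> lex_less r m y"
proof -
  define next_letter where "next_letter w = (SOME a. P (w @ [a]) \<and> (\<forall>b. P (w @ [b]) \<longrightarrow> (a, b) \<in> r))" for w
  define W where "W = rec_nat [] (\<lambda>_ w. w @ [next_letter w])"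
  define m where "m n = next_letter (W n)" for n
  have next_letter: "P (w @ [next_letter w]) \<and> (\<forall>b. P (w @ [b]) \<longrightarrow> (next_letter w, b) \<in> r)" if "P w" for w
  proof -
    let ?B = "{a. P (w @ [a])}"
    have "?B \<subseteq> A" using alphabet by auto
    moreover have "?B \<noteq> {}" using extend[OF that] by auto
    ultimately have "\<exists>a\<in>?B. \<forall>b\<in>?B. (a, b) \<in> r"
      using linear_order_least[OF r] fin finite_subset by metis
    then have "\<exists>a. P (w @ [a]) \<and> (\<forall>b. P (w @ [b]) \<longrightarrow> (a, b) \<in> r)" by auto
    then show ?thesis unfolding next_letter_def by (rule someI_ex)
  qed
  have W: "W n = prefix n m" for n
    by (induction n) (simp_all add: W_def m_def)
  have P: "P (prefix n m)" for n
  proof (induction n)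
    case 0
    then show ?case using nil by simp
  next
    case (Suc n)
    have "prefix (Suc n) m = prefix n m @ [next_letter (prefix n m)]"
      by (simp add: m_def[of n] W)
    then show ?case using next_letter[OF Suc] by simp
  qed
  have "y = m \<or> lex_less r m y" if y: "\<And>n. P (prefix n y)" for y
  proof (cases "y = m")
    case False
    then obtain n where n: "agree n y m" "y n \<noteq> m n" by (rule first_difference)
    have "prefix n y = prefix n m"
      using n(1) by (auto simp: agree_def subsequence_def)
    then have "P (prefix n m @ [y n])" using y[of "Suc n"] by simp
    with next_letter[OF P, of n] have "(m n, y n) \<in> r" by (simp add: m_def W)
    with n have "lex_less r m y"
      unfolding lex_less_def agree_def by (intro exI[of _ n]) auto
    then show ?thesis ..
  qed simp
  with P show ?thesis by (rule that)
qed

definition lex_least :: "'a rel \<Rightarrow> 'a word set \<Rightarrow> 'a word \<Rightarrow> bool" where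
  "lex_least r X m \<longleftrightarrow> m \<in> X \<and> (\<forall>y\<in>X. y = m \<or> lex_less r m y)"

lemma lex_least_exists:
  assumes r: "linear_order_on A r" and "finite A" "range x \<subseteq> A"
  obtains m where "lex_least r (shift_orbit_closure x) m"
proof -
  define P where "P w \<longleftrightarrow> (\<exists>i. w = prefix (length w) (suffix i x))" for w
  have P_iff: "P (prefix n y) \<longleftrightarrow> (\<exists>i. agree n y (suffix i x))" for n y
    by (simp add: P_def agree_def list_eq_iff_nth_eq)
  have "\<exists>a\<in>A. P (w @ [a])" if w: "P w" for w
  proof -
    obtain i where i: "w = prefix (length w) (suffix i x)" using w unfolding P_def by blast
    have "w @ [x (i + length w)] = prefix (Suc (length w)) (suffix i x)"
      using i by simp
    then have "P (w @ [x (i + length w)])" unfolding P_def by auto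
    then show ?thesis using \<open>range x \<subseteq> A\<close> by blast
  qed
  moreover have "a \<in> A" if wa: "P (w @ [a])" for w a
  proof -
    obtain i where "w @ [a] = prefix (length (w @ [a])) (suffix i x)"
      using wa unfolding P_def by blast
    then have "set (w @ [a]) = set (prefix (length (w @ [a])) (suffix i x))" by (rule arg_cong)
    then have "a \<in> range x" by auto
    then show ?thesis using \<open>range x \<subseteq> A\<close> by auto
  qed
  moreover have "P []" by (simp add: P_def)
  ultimately obtain m where m: "\<And>n. P (prefix n m)"
    "\<And>y. (\<And>n. P (prefix n y)) \<Longrightarrow> y = m \<or> lex_less r m y"
    using greedy_word[OF r \<open>finite A\<close>, of P] by blast
  have "lex_least r (shift_orbit_closure x) m"
    using m by (auto simp: lex_least_def in_closure_iff P_iff)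
  then show ?thesis by (rule that)
qed

text \<open>Compactness of the space of infinite words over a finite alphabet.\<close>

lemma limit_word:
  fixes f :: "nat \<Rightarrow> 'a word"
  assumes r: "linear_order_on A r" and "finite A" "\<And>n. range (f n) \<subseteq> A"
  obtains y where "\<And>k. \<exists>\<^sub>\<infinity>n. agree k y (f n)"
proof -
  define P where "P w \<longleftrightarrow> (\<exists>\<^sub>\<infinity>n. w = prefix (length w) (f n))" for w
  have P_iff: "P (prefix k y) \<longleftrightarrow> (\<exists>\<^sub>\<infinity>n. agree k y (f n))" for k y
    by (simp add: P_def agree_def list_eq_iff_nth_eq)
  have "\<exists>a\<in>A. P (w @ [a])" if "P w" for w
  proof -
    let ?N = "{n. w = prefix (length w) (f n)}"
    have "infinite ?N" using that by (simp add: P_def INFM_iff_infinite)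
    moreover have "finite ((\<lambda>n. f n (length w)) ` ?N)"
      by (rule finite_subset[OF _ \<open>finite A\<close>]) (use assms(3) in blast)
    \<comment> \<open>By the pigeonhole principle, some letter follows \<open>w\<close> infinitely often.\<close>
    ultimately obtain n0 where "n0 \<in> ?N"
      and inf: "infinite {n \<in> ?N. f n (length w) = f n0 (length w)}"
      using pigeonhole_infinite[of ?N "\<lambda>n. f n (length w)"] by auto
    have "{n \<in> ?N. f n (length w) = f n0 (length w)} \<subseteq>
      {n. w @ [f n0 (length w)] = prefix (length (w @ [f n0 (length w)])) (f n)}"
      by auto
    then have "P (w @ [f n0 (length w)])"
      unfolding P_def INFM_iff_infinite using inf infinite_super by blast
    then show ?thesis using assms(3) by blast
  qed
  moreover have "a \<in> A" if "P (w @ [a])" for w a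
  proof -
    have "\<exists>n. w @ [a] = prefix (length (w @ [a])) (f n)"
      using that unfolding P_def by (rule INFM_EX)
    then obtain n where "w @ [a] = prefix (length (w @ [a])) (f n)" ..
    then have "set (w @ [a]) = set (prefix (length (w @ [a])) (f n))" by (rule arg_cong)
    then have "a \<in> range (f n)" by auto
    then show ?thesis using assms(3) by auto
  qed
  moreover have "P []" by (simp add: P_def)
  ultimately obtain y where "\<And>k. P (prefix k y)"
    using greedy_word[OF r \<open>finite A\<close>, of P] by blast
  then have "\<And>k. \<exists>\<^sub>\<infinity>n. agree k y (f n)" unfolding P_iff .
  then show ?thesis by (rule that)
qed

section \<open>Purely periodic words\<close>

lemma periodic_mod:
  assumes "suffix p z = z"
  shows "z (n mod p) = z n" and "suffix (n mod p) z = suffix n z"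
proof -
  have period: "suffix (c * p) z = z" for c
    by (induction c) (simp, metis mult_Suc suffix_suffix assms)
  show *: "z (n mod p) = z n" for n
    using period[of "n div p"] by (metis suffix_nth div_mult_mod_eq)
  show "suffix (n mod p) z = suffix n z"
    by (metis period suffix_suffix div_mult_mod_eq)
qed

lemma aperiodic_tail_not_periodic:
  assumes "aperiodic x" "p > 0" "suffix p z = z"
  shows "suffix i x \<noteq> z"
proof
  assume "suffix i x = z"
  moreover have "z = (prefix p z)\<^sup>\<omega>"
    using periodic_mod(1)[OF assms(3)] assms(2) by (auto simp: fun_eq_iff)
  ultimately have "x = prefix i x \<frown> (prefix p z)\<^sup>\<omega>" by (metis prefix_suffix)
  moreover have "prefix p z \<noteq> []" using assms(2) by simp
  ultimately show False using assms(1) unfolding aperiodic_def ultimately_periodic_def by blast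
qed

section \<open>Lyndon words in the closure\<close>

lemma lex_least_lyndon_or_periodic:
  assumes r: "linear_order_on A r" and x: "range x \<subseteq> A"
    and m: "lex_least r (shift_orbit_closure x) m"
    and "\<not> lyndon_on A m"
  obtains p where "p > 0" "suffix p m = m"
proof -
  have "m \<in> shift_orbit_closure x" using m by (simp add: lex_least_def)
  then have "range m \<subseteq> A" using x by (rule closure_range)
  then obtain p where "p > 0" "\<not> lex_less r m (suffix p m)"
    using assms(4) r by (auto simp: lyndon_on_def)
  with m suffix_in_closure[OF \<open>m \<in> _\<close>, of p] that show ?thesis
    by (auto simp: lex_least_def)
qed

text \<open>
  A tail \<open>t\<close> of \<open>y\<close> does not begin with the prefix of \<open>m\<close> that \<open>y\<close> begins with, so \<open>m\<close> and \<open>t\<close> differ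
  within this prefix, where \<open>y\<close> cannot be told from \<open>m\<close>; thus \<open>m < t\<close> gives \<open>y < t\<close>.
\<close>

lemma lyndon_if_prefix_isolated:
  assumes r: "linear_order_on A r" and x: "range x \<subseteq> A"
    and m: "lex_least r (shift_orbit_closure x) m"
    and y: "y \<in> shift_orbit_closure x" "agree N m y"
    and isolated: "\<And>k. k > 0 \<Longrightarrow> \<not> agree N m (suffix k y)"
  shows "lyndon_on A y"
  unfolding lyndon_on_def
proof (intro conjI exI[of _ r] allI impI)
  show "range y \<subseteq> A" using y(1) x by (rule closure_range)
  show "linear_order_on A r" by fact
  fix k :: nat assume "k > 0"
  let ?t = "suffix k y"
  have not: "\<not> agree N m ?t" using isolated \<open>k > 0\<close> .
  then have "?t \<noteq> m" by (auto simp: agree_def)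
  then have "lex_less r m ?t"
    using m suffix_in_closure[OF y(1)] unfolding lex_least_def by blast
  then obtain n where n: "\<forall>i<n. m i = ?t i" "m n \<noteq> ?t n" "(m n, ?t n) \<in> r"
    unfolding lex_less_def by blast
  have "n < N" using not n(1) unfolding agree_def by (metis less_trans nat_neq_iff)
  then have "\<forall>i\<le>n. y i = m i" using y(2) by (simp add: agree_def)
  then show "lex_less r y ?t"
    using n unfolding lex_less_def by (intro exI[of _ n]) simp
qed

text \<open>
  Pure periodicity of \<open>z\<close> makes its prefixes occur arbitrarily far to the right in \<open>x\<close>, in particular
  to the right of a given occurrence of the prefix of \<open>m\<close> of length \<open>N\<close>.
\<close>

lemma lyndon_if_prefix_avoided:
  assumes r: "linear_order_on A r" and "finite A" and x: "range x \<subseteq> A"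
    and m: "lex_least r (shift_orbit_closure x) m"
    and z: "z \<in> shift_orbit_closure x" "p > 0" "suffix p z = z"
    and avoided: "\<And>k. \<not> agree N m (suffix k z)"
  obtains y where "y \<in> shift_orbit_closure x" "lyndon_on A y"
proof -
  let ?occ = "\<lambda>i. agree N m (suffix i x)"
  have "m \<in> shift_orbit_closure x" using m by (simp add: lex_least_def)
  then obtain i0 where i0: "?occ i0" by (auto simp: in_closure_iff)
  have period: "suffix (c * p) z = z" for c
    using periodic_mod(2)[OF z(3), of "c * p"] by simp
  have "\<exists>i. ?occ i \<and> (\<forall>k>0. k + N \<le> n \<longrightarrow> \<not> ?occ (i + k))" for n
  proof -
    \<comment> \<open>The first \<open>i0\<close> periods of this occurrence are skipped in order to get past position \<open>i0\<close>.\<close>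
    obtain i1 where i1: "agree (i0 * p + n) z (suffix i1 x)"
      using z(1) by (auto simp: in_closure_iff)
    define j where "j = i1 + i0 * p"
    have zj: "agree n z (suffix j x)"
      unfolding agree_def
    proof (intro allI impI)
      fix h assume "h < n"
      have "z h = z (i0 * p + h)" using period[of i0] by (metis suffix_nth)
      also have "\<dots> = x (j + h)" using i1 \<open>h < n\<close> by (simp add: agree_def j_def add.assoc)
      finally show "z h = suffix j x h" by simp
    qed
    have "i0 \<le> j" using z(2) by (simp add: j_def trans_le_add2)
    let ?I = "{i. i \<le> j \<and> ?occ i}"
    have I: "finite ?I" "?I \<noteq> {}" using i0 \<open>i0 \<le> j\<close> by auto
    \<comment> \<open>The last occurrence before the prefix of \<open>z\<close>: none starts between \<open>i\<close> and \<open>j\<close>, and none lies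
      inside the prefix because \<open>z\<close> avoids it.\<close>
    define i where "i = Max ?I"
    have i: "i \<le> j" "?occ i" using Max_in[OF I] by (auto simp: i_def)
    have "\<not> ?occ (i + k)" if k: "k > 0" "k + N \<le> n" for k
    proof
      assume occ: "?occ (i + k)"
      show False
      proof (cases "i + k \<le> j")
        case True
        then have "i + k \<le> i" unfolding i_def using occ by (intro Max_ge I(1)) (auto simp: i_def)
        with k show False by simp
      next
        case False
        define l where "l = i + k - j"
        have l: "i + k = j + l" "l + N \<le> n" using False k i(1) by (auto simp: l_def)
        have "agree N m (suffix l z)"
          unfolding agree_def
        proof (intro allI impI)
          fix h assume "h < N"
          then have "m h = x (j + (l + h))" using occ l(1) by (simp add: agree_def add.assoc)
          also have "\<dots> = z (l + h)" using zj l(2) \<open>h < N\<close> by (simp add: agree_def)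
          finally show "m h = suffix l z h" by simp
        qed
        with avoided show False by blast
      qed
    qed
    with i(2) show ?thesis by blast
  qed
  then obtain i where i: "\<And>n. ?occ (i n)"
    "\<And>n k. k > 0 \<Longrightarrow> k + N \<le> n \<Longrightarrow> \<not> ?occ (i n + k)" by metis
  obtain y where y: "\<And>k. \<exists>\<^sub>\<infinity>n. agree k y (suffix (i n) x)"
    by (rule limit_word[OF r \<open>finite A\<close>, of "\<lambda>n. suffix (i n) x"]) (use x in auto)
  have yX: "y \<in> shift_orbit_closure x"
    unfolding in_closure_iff using y by (meson INFM_EX)
  moreover have "lyndon_on A y"
  proof (rule lyndon_if_prefix_isolated[OF r x m yX])
    obtain n where "agree N y (suffix (i n) x)" using y by (meson INFM_EX)
    then show "agree N m y" using i(1)[of n] by (simp add: agree_def)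
  next
    fix k :: nat assume "k > 0"
    obtain n where n: "n > k + N" "agree (k + N) y (suffix (i n) x)"
      using y[of "k + N"] by (auto simp: INFM_nat)
    show "\<not> agree N m (suffix k y)"
    proof
      assume "agree N m (suffix k y)"
      then have "?occ (i n + k)" using n(2) by (auto simp: agree_def add.assoc)
      with i(2)[OF \<open>k > 0\<close>, of n] n(1) show False by simp
    qed
  qed
  ultimately show ?thesis by (rule that)
qed

text \<open>
  Here the freedom in choosing the order is used: the least word for \<open>r\<close> only excludes breaks to a
  letter that is smaller with respect to \<open>r\<close>, and the converse order excludes the other ones.
\<close>

theorem proposition4p8:
  fixes A :: "'a set" and x :: "'a word"
  assumes "finite A" and "A \<noteq> {}"
    and "range x \<subseteq> A"
    and "aperiodic x"
  shows "\<exists>y \<in> shift_orbit_closure x. lyndon_on A y"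
proof (rule ccontr)
  assume no_lyndon: "\<not> ?thesis"
  let ?X = "shift_orbit_closure x"
  obtain r0 where "well_order_on A r0" using well_order_on by blast
  then have r0: "linear_order_on A r0" by (simp add: well_order_on_def)
  then have r1: "linear_order_on A (r0\<inverse>)" by simp
  obtain z where z: "lex_least r0 ?X z"
    using lex_least_exists[OF r0 assms(1,3)] by blast
  then have zX: "z \<in> ?X" by (simp add: lex_least_def)
  then obtain p where p: "p > 0" "suffix p z = z"
    using lex_least_lyndon_or_periodic[OF r0 assms(3) z] no_lyndon by blast
  \<comment> \<open>An agreement of one full period puts the break at \<open>d \<ge> p\<close>, beyond every starting position
    inside the first period.\<close>
  obtain i where i: "agree p z (suffix i x)" using zX by (auto simp: in_closure_iff)
  have "suffix i x \<noteq> z" using aperiodic_tail_not_periodic[OF assms(4) p] .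
  then obtain d where d: "agree d (suffix i x) z" "x (i + d) \<noteq> z d"
    by (metis first_difference suffix_nth)
  have "p \<le> d" using i d(2) by (metis agree_def not_le suffix_nth)
  have "x (i + d) \<in> A" "z d \<in> A" using assms(3) closure_range[OF zX assms(3)] by auto
  then have "(x (i + d), z d) \<in> r0 \<or> (x (i + d), z d) \<in> r0\<inverse>"
    using r0 d(2) by (auto simp: linear_order_on_def total_on_def)
  then obtain r where r: "linear_order_on A r" "(x (i + d), z d) \<in> r"
    using r0 r1 by blast
  obtain m where m: "lex_least r ?X m"
    using lex_least_exists[OF r(1) assms(1,3)] by blast
  \<comment> \<open>The comparison takes place up to and including the break, hence the length \<open>Suc d\<close>.\<close>
  obtain k0 where "agree (Suc d) m (suffix k0 z)"
    using lyndon_if_prefix_avoided[OF r(1) assms(1,3) m zX p] no_lyndon by metis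
  moreover define k where "k = k0 mod p"
  ultimately have k: "agree (Suc d) m (suffix k z)"
    by (simp only: periodic_mod(2)[OF p(2)])
  have "k < p" using p(1) by (simp add: k_def)
  then have "k \<le> d" using \<open>p \<le> d\<close> by simp
  let ?t = "suffix (i + k) x"
  have "\<forall>h<d - k. ?t h = m h"
    using d(1) k by (auto simp: agree_def add.assoc)
  moreover have "m (d - k) = z d" "?t (d - k) = x (i + d)"
    using k \<open>k \<le> d\<close> by (auto simp: agree_def)
  ultimately have t: "lex_less r ?t m" "?t \<noteq> m"
    using r(2) d(2) unfolding lex_less_def by - (intro exI[of _ "d - k"], simp, auto)
  then have "lex_less r m ?t"
    using m tail_in_closure unfolding lex_least_def by blast
  moreover have "antisym r" using r(1) by (simp add: order_on_defs)
  ultimately show False using t(1) lex_less_asym by blast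
qed

end
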